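(* Let $\Omega\subset\mathbb{R}^N$ ($N=2,3$), $\mathbf{n}_k$, $\alpha$, $\beta$, the family $\{\mathcal{T}_h\}$ with quasi-uniformity parameter $\rho$, the spaces $V_h,\Pi_h$, the form $b$, and the constants $C_d,C_f,C_*$ be as in the context. Then $$\zeta\|\gamma\|_0\le\sup_{\mathbf{0}\ne\mathbf{v}\in V_h}\frac{|b(\mathbf{v},\gamma)|}{\|\mathbf{v}\|_{DC}}\qquad\forall\,\gamma\in\Pi_h,\qquad\text{with}\quad\zeta=h\left[\frac{2\alpha\rho^N}{9\,C_fC_*\sqrt{\beta C_d}}\right].$$
   Context: $\Omega\subset\mathbb{R}^N$ is an open bounded convex polyhedral domain (for $N=2$ vector fields still have three components, independent of $z$). $(\cdot,\cdot)$, $|\cdot|$ are the Euclidean inner product and norm; $\|\cdot\|_0$ the $L^2(\Omega)$ norm, $\|\cdot\|_1$ the $H^1(\Omega)$ norm; $\|\mathbf{v}\|_{DC}^2=\|\mathbf{v}\|_0^2+\|\nabla\cdot\mathbf{v}\|_0^2+\|\nabla\times\mathbf{v}\|_0^2$. $\{\mathcal{T}_h\}$, $0<h\le1$, is a family of quadrilateral (hexahedral if $N=3$) subdivisions of $\Omega$ with $\max\{\mathrm{diam}\,T:T\in\mathcal{T}_h\}\le h\,\mathrm{diam}\,\Omega$ and $\min\{\mathrm{diam}\,B_T:T\in\mathcal{T}_h\}\ge\rho\,h\,\mathrm{diam}\,\Omega$ for all $h$, where $\rho>0$ and $B_T$ is the largest ball contained in $T$ such that $T$ is star-shaped with respect to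 $B_T$. Every element of $\mathcal{T}_h$ is affine equivalent to a rectangular reference element (rectangular box if $N=3$), for all $h$. $Q_p$ denotes continuous piecewise polynomials of degree $p\ge1$ (in each variable) on $\mathcal{T}_h$; $P_0$ the piecewise constants. $b_T$ is the quadratic (in each variable) bubble function on $T\in\mathcal{T}_h$, vanishing on $\partial T$, positive inside $T$, with $\int_Tb_T\,dV=1$ (on a rectangle $[0,a]\times[0,b]$ a multiple of $xy(a-x)(b-y)$; on a box $[0,a]\times[0,b]\times[0,c]$ a multiple of $xyz(a-x)(b-y)(c-z)$; on an affine image, the normalized composition with the inverse affine map). $\mathbf{n}_k\in Q_p\times Q_p\times Q_p$ for some $p\ge1$, with $\alpha\le|\mathbf{n}_k|^2\le\beta$ on $\Omega$, $0<\alpha\le1\le\beta$, such that, with $\kappa=K_2/K_3>0$ ($K_2,K_3>0$ material constants), $\mathbf{I}-(1-\kappa)\mathbf{n}_k\otimes\mathbf{n}_k$ is uniformly symmetric positive definite on $\Omega$. Fix $m\ge1$; $V_h^b=\{\mathbf{v}\text{ continuous on }\overline\Omega\text{ with values in }\mathbb{R}^3,\ \mathbf{v}=\mathbf{0}\text{ on }\partial\Omega:\ \mathbf{v}|_T=a_Tb_T\mathbf{n}_k|_T\ \forall T\in\mathcal{T}_h,\ a_T\in\mathbb{R}\}$, $\Pi_h=P_0$, $V_h=\{\mathbf{v}\in Q_m\times Q_m\times Q_m\oplus V_h^b:\mathbf{v}=\mathbf{0}\text{ on }\partial\Omega\}$; so $V_h\subset Q_l\times Q_l\times Q_l$ with $l=\max(m,p+2)$.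 The form is $b(\mathbf{v},\gamma)=\int_\Omega\gamma(\mathbf{n}_k,\mathbf{v})\,dV$. Constants: $C_d=(3/2)^N$; $C_*>0$ is the constant, depending only on $\rho$, of the inverse inequality $\|\mathbf{v}\|_1\le C_*h^{-1}\|\mathbf{v}\|_0$ for all $\mathbf{v}\in V_h$; $C_f>0$ is a constant with $\|\mathbf{v}\|_{DC}\le C_f\|\mathbf{v}\|_1$ for all $\mathbf{v}\in V_h$. *)

theory Defs
  imports "HOL-Analysis.Analysis"
begin

section \<open>Domain and coordinates\<close>

definition polyhedral_domain :: "(real^'n) set \<Rightarrow> bool" where
  "polyhedral_domain \<Omega> \<longleftrightarrow>
     \<Omega> \<noteq> {} \<and> open \<Omega> \<and> bounded \<Omega> \<and> convex \<Omega> \<and> polyhedron (closure \<Omega>)"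

text \<open>
  Vector fields have three components for both values of the dimension, so the coordinate axes
  of the domain space are labelled by elements of the type \<^typ>\<open>3\<close>: by x, y (1 and 2) if the
  dimension is 2, and by x, y, z if it is 3. Examples are the identity on \<^typ>\<open>3\<close>, and the map
  from \<^typ>\<open>2\<close> to \<^typ>\<open>3\<close> sending 1 to 1 and 2 to 2.
\<close>

definition axis_labelling :: "('n::finite \<Rightarrow> 3) \<Rightarrow> bool" where
  "axis_labelling \<iota> \<longleftrightarrow> inj \<iota> \<and> (range \<iota> = {1, 2} \<or> range \<iota> = {1, 2, 3})"

text \<open>
  The unit vector along the axis labelled k. In dimension 2 there is no axis with label 3; then
  this is the zero vector and derivatives in that direction vanish, which is the convention that
  fields do not depend on z.
\<close>

definition axis_dir :: "('n::finite \<Rightarrow> 3) \<Rightarrow> 3 \<Rightarrow> real^'n" where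
  "axis_dir \<iota> k = (\<chi> i. if \<iota> i = k then 1 else 0)"

section \<open>Weak derivatives and norms\<close>

text \<open>
  Integrals are over the completed Lebesgue measure, so that values on the element boundaries
  are irrelevant, also for measurability. Continuously differentiable test functions with
  compact support define the same weak first derivatives as smooth ones.
\<close>

definition test_functions :: "(real^'n) set \<Rightarrow> (real^'n \<Rightarrow> real) set" where
  "test_functions \<Omega> = {\<phi>.
     (\<forall>x. \<phi> differentiable (at x)) \<and>
     (\<forall>d. continuous_on UNIV (\<lambda>x. frechet_derivative \<phi> (at x) d)) \<and>
     compact (closure {x. \<phi> x \<noteq> 0}) \<and> closure {x. \<phi> x \<noteq> 0} \<subseteq> \<Omega>}"

definition is_weak_derivative ::
  "(real^'n) set \<Rightarrow> real^'n \<Rightarrow> (real^'n \<Rightarrow> real) \<Rightarrow> (real^'n \<Rightarrow> real) \<Rightarrow> bool" where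
  "is_weak_derivative \<Omega> d u g \<longleftrightarrow>
     (\<forall>K. compact K \<and> K \<subseteq> \<Omega> \<longrightarrow> set_integrable lebesgue K g) \<and>
     (\<forall>\<phi>\<in>test_functions \<Omega>.
        (LINT x:\<Omega>|lebesgue. u x * frechet_derivative \<phi> (at x) d)
        = - (LINT x:\<Omega>|lebesgue. g x * \<phi> x))"

text \<open>
  A weak derivative is determined up to a null set, so its choice does not affect the norms
  below. Every function in the finite element spaces below, being continuous and piecewise
  polynomial, has weak partial derivatives.
\<close>

definition wpartial ::
  "(real^'n) set \<Rightarrow> ('n \<Rightarrow> 3) \<Rightarrow> 3 \<Rightarrow> (real^'n \<Rightarrow> real) \<Rightarrow> real^'n \<Rightarrow> real" where
  "wpartial \<Omega> \<iota> k u = (SOME g. is_weak_derivative \<Omega> (axis_dir \<iota> k) u g)"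

definition divergence ::
  "(real^'n) set \<Rightarrow> ('n \<Rightarrow> 3) \<Rightarrow> (real^'n \<Rightarrow> real^3) \<Rightarrow> real^'n \<Rightarrow> real" where
  "divergence \<Omega> \<iota> v x = (\<Sum>k\<in>UNIV. wpartial \<Omega> \<iota> k (\<lambda>y. v y $ k) x)"

definition curl ::
  "(real^'n) set \<Rightarrow> ('n \<Rightarrow> 3) \<Rightarrow> (real^'n \<Rightarrow> real^3) \<Rightarrow> real^'n \<Rightarrow> real^3" where
  "curl \<Omega> \<iota> v x =
     (let D = (\<lambda>k i. wpartial \<Omega> \<iota> k (\<lambda>y. v y $ i) x)
      in vector [D 2 3 - D 3 2, D 3 1 - D 1 3, D 1 2 - D 2 1])"

definition L2_norm_on :: "(real^'n) set \<Rightarrow> (real^'n \<Rightarrow> 'b::real_normed_vector) \<Rightarrow> real" where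
  "L2_norm_on \<Omega> u = sqrt (LINT x:\<Omega>|lebesgue. (norm (u x))\<^sup>2)"

definition H1_norm :: "(real^'n) set \<Rightarrow> ('n \<Rightarrow> 3) \<Rightarrow> (real^'n \<Rightarrow> real^3) \<Rightarrow> real" where
  "H1_norm \<Omega> \<iota> v =
     sqrt ((L2_norm_on \<Omega> v)\<^sup>2 +
       (\<Sum>i\<in>UNIV. \<Sum>k\<in>UNIV. (L2_norm_on \<Omega> (wpartial \<Omega> \<iota> k (\<lambda>y. v y $ i)))\<^sup>2))"

definition DC_norm :: "(real^'n) set \<Rightarrow> ('n \<Rightarrow> 3) \<Rightarrow> (real^'n \<Rightarrow> real^3) \<Rightarrow> real" where
  "DC_norm \<Omega> \<iota> v =
     sqrt ((L2_norm_on \<Omega> v)\<^sup>2 + (L2_norm_on \<Omega> (divergence \<Omega> \<iota> v))\<^sup>2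
           + (L2_norm_on \<Omega> (curl \<Omega> \<iota> v))\<^sup>2)"

section \<open>Meshes\<close>

definition reference_map ::
  "real^'n \<Rightarrow> (real^'n \<Rightarrow> real^'n) \<Rightarrow> (real^'n) set \<Rightarrow> bool" where
  "reference_map a A T \<longleftrightarrow>
     (\<forall>i. 0 < a $ i) \<and>
     (\<exists>M c. invertible M \<and> A = (\<lambda>x. M *v x + c)) \<and>
     A ` cbox 0 a = T"

text \<open>Elements are closed sets; they may share boundary points but not interior points.\<close>

definition box_subdivision :: "(real^'n) set \<Rightarrow> (real^'n) set set \<Rightarrow> bool" where
  "box_subdivision \<Omega> \<T> \<longleftrightarrow>
     finite \<T> \<and>
     (\<forall>T\<in>\<T>. \<exists>a A. reference_map a A T) \<and>
     (\<forall>S\<in>\<T>. \<forall>T\<in>\<T>. S \<noteq> T \<longrightarrow> interior S \<inter> interior T = {}) \<and>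
     \<Union>\<T> = closure \<Omega>"

definition star_shaped_wrt :: "(real^'n) set \<Rightarrow> (real^'n) set \<Rightarrow> bool" where
  "star_shaped_wrt T B \<longleftrightarrow> (\<forall>x\<in>T. \<forall>y\<in>B. closed_segment x y \<subseteq> T)"

definition star_ball :: "(real^'n) set \<Rightarrow> real^'n \<Rightarrow> real \<Rightarrow> bool" where
  "star_ball T z r \<longleftrightarrow> 0 < r \<and> ball z r \<subseteq> T \<and> star_shaped_wrt T (ball z r)"

definition largest_star_ball :: "(real^'n) set \<Rightarrow> (real^'n) set \<Rightarrow> bool" where
  "largest_star_ball T B \<longleftrightarrow>
     (\<exists>z r. B = ball z r \<and> star_ball T z r \<and> (\<forall>z' r'. star_ball T z' r' \<longrightarrow> r' \<le> r))"

definition quasi_uniform_family ::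
  "(real^'n) set \<Rightarrow> real \<Rightarrow> (real \<Rightarrow> (real^'n) set set) \<Rightarrow> bool" where
  "quasi_uniform_family \<Omega> \<rho> \<T> \<longleftrightarrow>
     0 < \<rho> \<and>
     (\<forall>h. 0 < h \<and> h \<le> 1 \<longrightarrow>
        box_subdivision \<Omega> (\<T> h) \<and>
        (\<forall>T\<in>\<T> h. diameter T \<le> h * diameter \<Omega>) \<and>
        (\<forall>T\<in>\<T> h. \<exists>B. largest_star_ball T B \<and> \<rho> * h * diameter \<Omega> \<le> diameter B))"

section \<open>Finite element spaces\<close>

definition tensor_polynomials :: "nat \<Rightarrow> (real^'n \<Rightarrow> real) set" where
  "tensor_polynomials p =
     {q. \<exists>c :: ('n \<Rightarrow> nat) \<Rightarrow> real.
           \<forall>x. q x = (\<Sum>e | \<forall>i. e i \<le> p. c e * (\<Prod>i\<in>UNIV. (x $ i) ^ e i))}"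

text \<open>
  The degree in each variable is measured in the coordinates of the reference box. It does not
  depend on the affine map chosen, since two such maps differ by a map that scales, reflects and
  permutes the coordinates. Functions on the closure of the domain are represented by total
  functions whose values elsewhere are arbitrary.
\<close>

definition Q_space ::
  "(real^'n) set \<Rightarrow> (real^'n) set set \<Rightarrow> nat \<Rightarrow> (real^'n \<Rightarrow> real) set" where
  "Q_space \<Omega> \<T> p =
     {u. continuous_on (closure \<Omega>) u \<and>
         (\<forall>T\<in>\<T>. \<exists>a A. reference_map a A T \<and>
            (\<exists>q\<in>tensor_polynomials p. \<forall>x\<in>cbox 0 a. u (A x) = q x))}"

definition Q_space3 ::
  "(real^'n) set \<Rightarrow> (real^'n) set set \<Rightarrow> nat \<Rightarrow> (real^'n \<Rightarrow> real^3) set" where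
  "Q_space3 \<Omega> \<T> p = {v. \<forall>k. (\<lambda>x. v x $ k) \<in> Q_space \<Omega> \<T> p}"

definition P0_space :: "(real^'n) set set \<Rightarrow> (real^'n \<Rightarrow> real) set" where
  "P0_space \<T> = {\<gamma>. \<forall>T\<in>\<T>. \<exists>c. \<forall>x\<in>interior T. \<gamma> x = c}"

definition is_bubble :: "(real^'n) set \<Rightarrow> (real^'n \<Rightarrow> real) \<Rightarrow> bool" where
  "is_bubble T b \<longleftrightarrow>
     (\<exists>a A c. reference_map a A T \<and>
        (\<forall>x\<in>cbox 0 a. b (A x) = c * (\<Prod>i\<in>UNIV. x $ i * (a $ i - x $ i)))) \<and>
     (LINT x:T|lebesgue. b x) = 1"

text \<open>
  The values on an element are uniquely determined: two reference maps give the same product up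
  to a constant factor, and the factor is fixed (and positive) by the normalization.
\<close>

definition bubble :: "(real^'n) set \<Rightarrow> real^'n \<Rightarrow> real" where
  "bubble T = (SOME b. is_bubble T b)"

definition V_bubble ::
  "(real^'n) set \<Rightarrow> (real^'n) set set \<Rightarrow> (real^'n \<Rightarrow> real^3) \<Rightarrow> (real^'n \<Rightarrow> real^3) set" where
  "V_bubble \<Omega> \<T> n =
     {v. continuous_on (closure \<Omega>) v \<and> (\<forall>x\<in>frontier \<Omega>. v x = 0) \<and>
         (\<forall>T\<in>\<T>. \<exists>a. \<forall>x\<in>T. v x = (a * bubble T x) *\<^sub>R n x)}"

definition V_space ::
  "(real^'n) set \<Rightarrow> (real^'n) set set \<Rightarrow> (real^'n \<Rightarrow> real^3) \<Rightarrow> nat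
     \<Rightarrow> (real^'n \<Rightarrow> real^3) set" where
  "V_space \<Omega> \<T> n m =
     {v. (\<exists>w\<in>Q_space3 \<Omega> \<T> m. \<exists>u\<in>V_bubble \<Omega> \<T> n. \<forall>x\<in>closure \<Omega>. v x = w x + u x) \<and>
         (\<forall>x\<in>frontier \<Omega>. v x = 0)}"

section \<open>Director field and bilinear form\<close>

definition outer_product :: "real^3 \<Rightarrow> real^3 \<Rightarrow> real^3^3" where
  "outer_product u v = (\<chi> i j. u $ i * v $ j)"

definition uniformly_spd :: "'a set \<Rightarrow> ('a \<Rightarrow> real^3^3) \<Rightarrow> bool" where
  "uniformly_spd \<Omega> D \<longleftrightarrow>
     (\<forall>x\<in>\<Omega>. transpose (D x) = D x) \<and>
     (\<exists>c>0. \<forall>x\<in>\<Omega>. \<forall>\<xi>. c * (\<xi> \<bullet> \<xi>) \<le> \<xi> \<bullet> (D x *v \<xi>))"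

definition b_form ::
  "(real^'n) set \<Rightarrow> (real^'n \<Rightarrow> real^3) \<Rightarrow> (real^'n \<Rightarrow> real^3) \<Rightarrow> (real^'n \<Rightarrow> real) \<Rightarrow> real" where
  "b_form \<Omega> n v \<gamma> = (LINT x:\<Omega>|lebesgue. \<gamma> x * (n x \<bullet> v x))"

end

theory Submission
  imports Defs
begin

text \<open>
  Let \<open>\<gamma>\<close> take the value \<open>\<gamma>\<^sub>T\<close> on the element \<open>T\<close>. The supremum is bounded below by testing
  with a single field: the bubble field \<open>v = (\<Sum>T. a\<^sub>T b\<^sub>T) n\<close> with \<open>a\<^sub>T = \<gamma>\<^sub>T |T|\<close>.
  Since \<open>b\<^sub>T\<close> has integral 1 and \<open>|n|\<^sup>2 \<ge> \<alpha>\<close>, this gives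
  \<open>b(v, \<gamma>) \<ge> \<alpha> (\<Sum>T. \<gamma>\<^sub>T\<^sup>2 |T|) = \<alpha> \<parallel>\<gamma>\<parallel>\<^sup>2\<close> (lemma \<open>b_form_bubble_field\<close>).

  In the other direction, one factor of a normalized bubble is \<open>6 t (s - t) / s\<^sup>3 \<le> (3/2) / s\<close>
  on an edge of length \<open>s\<close>, so that \<open>0 \<le> b\<^sub>T \<le> (3/2)\<^sup>N / |T|\<close> on \<open>T\<close>, and hence
  \<open>\<integral>b\<^sub>T\<^sup>2 \<le> C\<^sub>d / |T|\<close>. Thus \<open>\<parallel>v\<parallel>\<^sub>0\<^sup>2 \<le> \<beta> C\<^sub>d (\<Sum>T. a\<^sub>T\<^sup>2 / |T|) = \<beta> C\<^sub>d \<parallel>\<gamma>\<parallel>\<^sup>2\<close>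
  (lemma \<open>L2_norm_bubble_field\<close>). The inverse inequality and the bound by \<open>C\<^sub>f\<close> turn this into
  \<open>\<parallel>v\<parallel>\<^sub>D\<^sub>C \<le> C\<^sub>f C\<^sub>s h\<^sup>-\<^sup>1 sqrt (\<beta> C\<^sub>d) \<parallel>\<gamma>\<parallel>\<close>. Dividing gives the claim with the constant
  \<open>h \<alpha> / (C\<^sub>f C\<^sub>s sqrt (\<beta> C\<^sub>d))\<close>, which is at least \<open>\<zeta>\<close>: a ball inside an element is no wider
  than the element, so \<open>\<rho> \<le> 1\<close> and \<open>2 \<rho>\<^sup>N / 9 \<le> 1\<close>.

  The ratio divides by \<open>\<parallel>v\<parallel>\<^sub>D\<^sub>C\<close>, so the test field must also be nonzero in \<open>L\<^sup>2\<close>. This follows from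
  the companion bound \<open>\<integral>b\<^sub>T\<^sup>2 \<ge> 1 / |T|\<close>, an instance of the Cauchy-Schwarz inequality. If
  \<open>\<gamma> = 0\<close>, the field with all \<open>a\<^sub>T = 1\<close> shows that the supremum is not negative.

  The one computation is the mean value of a bubble over an element, in which the factor by which
  an affine map scales volume cancels. The lemma \<open>nn_integral_affine_ratio\<close> therefore transports
  mean values between the element and the reference box without a determinant.
\<close>

section \<open>Affine changes of variables\<close>

lemma nn_integral_lborel_translate:
  fixes c :: "'a::euclidean_space"
  assumes [measurable]: "f \<in> borel_measurable borel"
  shows "(\<integral>\<^sup>+x. f (c + x) \<partial>lborel) = (\<integral>\<^sup>+x. f x \<partial>lborel)"
proof -
  have "(\<integral>\<^sup>+x. f x \<partial>lborel) = (\<integral>\<^sup>+x. f x \<partial>distr lborel borel ((+) c))"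
    by (simp only: lborel_distr_plus)
  also have "\<dots> = (\<integral>\<^sup>+x. f (c + x) \<partial>lborel)"
    by (rule nn_integral_distr) auto
  finally show ?thesis ..
qed

lemma nn_integral_lborel_reflect:
  fixes c :: "'a::euclidean_space"
  assumes [measurable]: "f \<in> borel_measurable borel"
  shows "(\<integral>\<^sup>+x. f (c - x) \<partial>lborel) = (\<integral>\<^sup>+x. f x \<partial>lborel)"
proof -
  have "(lborel :: 'a measure) = distr lborel borel (\<lambda>x. c - x)"
    using lborel_affine[of "-1" c] by (simp add: density_1)
  then have "(\<integral>\<^sup>+x. f x \<partial>lborel) = (\<integral>\<^sup>+x. f x \<partial>distr lborel borel (\<lambda>x. c - x))"
    by simp
  also have "\<dots> = (\<integral>\<^sup>+x. f (c - x) \<partial>lborel)"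
    by (rule nn_integral_distr) auto
  finally show ?thesis ..
qed

text \<open>
  Composition with an affine bijection \<open>A\<close> multiplies all integrals by one and the same factor.
  The classical argument for uniqueness of Haar measure shows this without naming the factor:
  in the double integral of \<open>f (A x) g (y)\<close>, replace \<open>y\<close> by \<open>A x + y\<close>, then \<open>x\<close> by \<open>x - L y\<close>,
  and finally \<open>y\<close> by \<open>A x - y\<close>. Each step leaves Lebesgue measure invariant, and together
  they exchange the roles of \<open>f\<close> and \<open>g\<close>. Here \<open>L\<close> plays the
  role of the inverse of the linear part of \<open>A\<close>.
\<close>

lemma nn_integral_affine_ratio:
  fixes A L :: "'a::euclidean_space \<Rightarrow> 'a"
  assumes shift: "\<And>x y. A (x - L y) = A x - y"
    and [measurable]: "A \<in> borel_measurable borel" "L \<in> borel_measurable borel"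
      "f \<in> borel_measurable borel" "g \<in> borel_measurable borel"
  shows "(\<integral>\<^sup>+x. f (A x) \<partial>lborel) * (\<integral>\<^sup>+x. g x \<partial>lborel)
       = (\<integral>\<^sup>+x. g (A x) \<partial>lborel) * (\<integral>\<^sup>+x. f x \<partial>lborel)"
proof -
  have "(\<integral>\<^sup>+x. f (A x) \<partial>lborel) * (\<integral>\<^sup>+x. g x \<partial>lborel)
      = (\<integral>\<^sup>+x. f (A x) * (\<integral>\<^sup>+y. g (A x + y) \<partial>lborel) \<partial>lborel)"
    by (simp add: nn_integral_lborel_translate nn_integral_multc)
  also have "\<dots> = (\<integral>\<^sup>+x. \<integral>\<^sup>+y. f (A x) * g (A x + y) \<partial>lborel \<partial>lborel)"
    by (simp add: nn_integral_cmult)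
  also have "\<dots> = (\<integral>\<^sup>+y. \<integral>\<^sup>+x. f (A x) * g (A x + y) \<partial>lborel \<partial>lborel)"
    by (rule lborel_pair.Fubini') measurable
  also have "\<dots> = (\<integral>\<^sup>+y. \<integral>\<^sup>+x. f (A x - y) * g (A x) \<partial>lborel \<partial>lborel)"
  proof (rule nn_integral_cong)
    fix y
    have "(\<integral>\<^sup>+x. f (A x) * g (A x + y) \<partial>lborel)
        = (\<integral>\<^sup>+x. f (A (- L y + x)) * g (A (- L y + x) + y) \<partial>lborel)"
      by (rule nn_integral_lborel_translate[symmetric]) measurable
    also have "\<dots> = (\<integral>\<^sup>+x. f (A x - y) * g (A x) \<partial>lborel)"
      using shift by (simp add: add.commute)
    finally show "(\<integral>\<^sup>+x. f (A x) * g (A x + y) \<partial>lborel)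
        = (\<integral>\<^sup>+x. f (A x - y) * g (A x) \<partial>lborel)" .
  qed
  also have "\<dots> = (\<integral>\<^sup>+x. \<integral>\<^sup>+y. f (A x - y) * g (A x) \<partial>lborel \<partial>lborel)"
    by (rule lborel_pair.Fubini') measurable
  also have "\<dots> = (\<integral>\<^sup>+x. f x \<partial>lborel) * (\<integral>\<^sup>+x. g (A x) \<partial>lborel)"
    by (simp add: nn_integral_multc nn_integral_cmult nn_integral_lborel_reflect)
  also have "\<dots> = (\<integral>\<^sup>+x. g (A x) \<partial>lborel) * (\<integral>\<^sup>+x. f x \<partial>lborel)"
    by (rule mult.commute)
  finally show ?thesis .
qed

section \<open>Bubble functions\<close>

lemma nn_integral_interval_bubble:
  fixes s :: real
  assumes "0 \<le> s"
  shows "(\<integral>\<^sup>+t. ennreal (t * (s - t)) * indicator {0..s} t \<partial>lborel) = ennreal (s ^ 3 / 6)"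
proof -
  have "(\<integral>\<^sup>+t. ennreal (t * (s - t)) * indicator {0..s} t \<partial>lborel)
      = ennreal ((s * s\<^sup>2 / 2 - s ^ 3 / 3) - (s * 0\<^sup>2 / 2 - 0 ^ 3 / 3))"
    by (rule nn_integral_FTC_Icc)
       (use assms in \<open>auto intro!: derivative_eq_intros mult_left_mono simp: algebra_simps power2_eq_square\<close>)
  also have "(s * s\<^sup>2 / 2 - s ^ 3 / 3) - (s * 0\<^sup>2 / 2 - 0 ^ 3 / 3) = s ^ 3 / 6"
    by (simp add: power2_eq_square power3_eq_cube)
  finally show ?thesis .
qed

lemma prod_Basis_cart:
  "(\<Prod>b\<in>(Basis :: (real^'n) set). h b) = (\<Prod>i\<in>UNIV. h (axis i 1))"
  by (simp add: Basis_vec_def UNION_singleton_eq_range prod.reindex axis_eq_axis inj_on_def)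

text \<open>The bubble of the reference box with opposite corners 0 and \<open>a\<close>, before normalization.\<close>

definition box_bubble :: "real^'n \<Rightarrow> real^'n \<Rightarrow> real" where
  "box_bubble a x = (\<Prod>i\<in>UNIV. x $ i * (a $ i - x $ i))"

lemma continuous_on_box_bubble: "continuous_on S (box_bubble a)"
  unfolding box_bubble_def by (intro continuous_intros)

text \<open>
  Cut off to the box, the bubble is a product of functions of one coordinate each, so that its
  integral is the product of the one-dimensional integrals. The cut-off also makes every factor
  nonnegative.
\<close>

lemma nn_integral_box_bubble:
  fixes a :: "real^'n"
  assumes a: "\<And>i. 0 < a $ i"
  shows "(\<integral>\<^sup>+x. ennreal (box_bubble a x) * indicator (cbox 0 a) x \<partial>lborel)
       = ennreal (\<Prod>i\<in>UNIV. (a $ i) ^ 3 / 6)"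
proof -
  define f where "f b t = ennreal (t * (a \<bullet> b - t)) * indicator {0..a \<bullet> b} t"
    for b :: "real^'n" and t :: real
  have "ennreal (box_bubble a x) * indicator (cbox 0 a) x = (\<Prod>b\<in>Basis. f b (x \<bullet> b))" for x
  proof (cases "x \<in> cbox 0 a")
    case True
    then show ?thesis
      by (simp add: prod_Basis_cart f_def inner_axis box_bubble_def mem_box_cart prod_ennreal)
  next
    case False
    then obtain i where "x $ i \<notin> {0..a $ i}"
      by (auto simp: mem_box_cart)
    then have "f (axis i 1) (x \<bullet> axis i 1) = 0"
      by (simp add: f_def inner_axis)
    then have "(\<Prod>b\<in>Basis. f b (x \<bullet> b)) = 0"
      by (auto simp: prod_Basis_cart)
    with False show ?thesis by simp
  qed
  then have "(\<integral>\<^sup>+x. ennreal (box_bubble a x) * indicator (cbox 0 a) x \<partial>lborel)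
      = (\<integral>\<^sup>+x. (\<Prod>b\<in>Basis. f b (x \<bullet> b)) \<partial>lborel)"
    by simp
  also have "\<dots> = (\<Prod>b\<in>Basis. (\<integral>\<^sup>+t. f b t \<partial>lborel))"
    by (rule nn_integral_lborel_prod) (auto simp: f_def)
  also have "\<dots> = (\<Prod>i\<in>UNIV. ennreal ((a $ i) ^ 3 / 6))"
    using a by (simp add: prod_Basis_cart f_def inner_axis nn_integral_interval_bubble less_imp_le)
  also have "\<dots> = ennreal (\<Prod>i\<in>UNIV. (a $ i) ^ 3 / 6)"
    using a by (intro prod_ennreal) (simp add: less_imp_le)
  finally show ?thesis .
qed

text \<open>
  The properties of a reference map that the analysis uses; they avoid its matrix.
  \<open>B\<close> is the inverse map, and \<open>L\<close> the linear part of \<open>B\<close>.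
\<close>

lemma reference_map_inverse:
  assumes "reference_map a A T"
  obtains B L where "\<And>x. B (A x) = x" "\<And>x y. A (x - L y) = A x - y"
    "continuous_on UNIV A" "continuous_on UNIV B" "continuous_on UNIV L"
    "open (A ` box 0 a)" "convex T"
proof -
  obtain M c where M: "invertible M" and A: "A = (\<lambda>x. M *v x + c)" and T: "A ` cbox 0 a = T"
    using assms unfolding reference_map_def by auto
  obtain N where N: "M ** N = mat 1" "N ** M = mat 1"
    using M unfolding invertible_def by auto
  have MN: "M *v (N *v x) = x" "N *v (M *v x) = x" for x
    using N by (auto simp: matrix_vector_mul_assoc)
  have A': "A ` S = (+) c ` ((*v) M ` S)" for S
    unfolding A image_image by (auto simp: add.commute)
  show thesis
  proof (rule that[of "\<lambda>z. N *v (z - c)" "\<lambda>y. N *v y"])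
    show "N *v (A x - c) = x" for x
      by (simp add: A MN)
    show "A (x - N *v y) = A x - y" for x y
      by (simp add: A matrix_vector_mult_diff_distrib MN)
    show "continuous_on UNIV A" "continuous_on UNIV (\<lambda>z. N *v (z - c))"
      "continuous_on UNIV (\<lambda>y. N *v y)"
      unfolding A by (intro continuous_intros matrix_vector_mult_linear_continuous_on
          continuous_on_compose2[OF matrix_vector_mult_linear_continuous_on[of UNIV N]] subset_UNIV)+
    have "surj ((*v) M)"
      by (metis MN(1) surjI)
    then show "open (A ` box 0 a)"
      unfolding A' by (intro open_translation open_surjective_linear_image) auto
    show "convex T"
      unfolding T[symmetric] A'
      by (intro convex_translation convex_linear_image) (auto simp: convex_box)
  qed
qed

lemma absolutely_integrable_continuous_compact:
  fixes f :: "'a::euclidean_space \<Rightarrow> 'b::{banach, second_countable_topology}"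
  assumes "compact S" "continuous_on S f"
  shows "set_integrable lebesgue S f"
  using borel_integrable_compact[OF assms]
  unfolding set_integrable_def by (simp add: integrable_completion borel_measurable_integrable)

text \<open>
  An element has nonempty interior, hence positive volume, because it contains the open image of
  the open box. That image also contains all points at which the bubble can be positive.
\<close>

lemma reference_map_image_facts:
  fixes a :: "real^'n"
  assumes "reference_map a A T"
  shows "compact T" "convex T" "interior T \<noteq> {}" "closure (interior T) = T"
    "A ` box 0 a \<subseteq> interior T" "0 < measure lebesgue T"
proof -
  obtain B where A: "continuous_on UNIV A" and op: "open (A ` box 0 a)" and cv: "convex T"
    using reference_map_inverse[OF assms] by metis
  have a: "\<And>i. 0 < a $ i" and T: "A ` cbox 0 a = T"
    using assms unfolding reference_map_def by auto
  show compact: "compact T"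
    unfolding T[symmetric]
    by (intro compact_continuous_image compact_cbox continuous_on_subset[OF A] subset_UNIV)
  show "convex T" by fact
  show sub: "A ` box 0 a \<subseteq> interior T"
    using op T box_subset_cbox by (metis image_mono interior_maximal)
  have "box 0 a \<noteq> {}"
    using a by (simp add: interval_ne_empty_cart)
  with sub show ne: "interior T \<noteq> {}" by auto
  show "closure (interior T) = T"
    using convex_closure_interior[OF cv ne] compact by (simp add: closure_closed compact_imp_closed)
  have "\<not> negligible T"
    using ne by (metis interior_subset negligible_subset open_interior open_not_negligible)
  then show "0 < measure lebesgue T"
    using lmeasurable_compact[OF compact] by (simp add: negligible_iff_measure0 zero_less_measure_iff)
qed

text \<open>
  The mean value of the bubble is the same over the element as over the reference box, by
  \<open>nn_integral_affine_ratio\<close> with the indicator of the element as the second function. Over the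
  box it is the product of \<open>(s\<^sup>3 / 6) / s = s\<^sup>2 / 6\<close> over the edge lengths \<open>s\<close>.
\<close>

lemma integral_mapped_box_bubble:
  fixes a :: "real^'n"
  assumes ref: "reference_map a A T"
    and inv: "\<And>x. B (A x) = x" "continuous_on UNIV B"
  shows "(LINT z:T|lebesgue. box_bubble a (B z))
       = (\<Prod>i\<in>UNIV. (a $ i)\<^sup>2 / 6) * measure lebesgue T"
proof -
  obtain L where shift: "\<And>x y. A (x - L y) = A x - y"
    and cont: "continuous_on UNIV A" "continuous_on UNIV L"
    using reference_map_inverse[OF ref] by metis
  have a: "\<And>i. 0 < a $ i" and T: "A ` cbox 0 a = T"
    using ref unfolding reference_map_def by auto
  have compact: "compact T"
    by (rule reference_map_image_facts[OF ref])
  have [measurable]: "A \<in> borel_measurable borel" "B \<in> borel_measurable borel"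
      "L \<in> borel_measurable borel" "T \<in> sets borel" "box_bubble a \<in> borel_measurable borel"
    using cont inv(2) compact continuous_on_box_bubble
    by (auto intro: borel_measurable_continuous_onI borel_compact)
  have mem: "A x \<in> T \<longleftrightarrow> x \<in> cbox 0 a" for x
    unfolding T[symmetric] using inv(1) by (metis imageE imageI)
  define f where "f z = ennreal (box_bubble a (B z)) * indicator T z" for z
  have [measurable]: "f \<in> borel_measurable borel"
    unfolding f_def by measurable
  define g :: "real^'n \<Rightarrow> real" where "g z = indicator T z *\<^sub>R box_bubble a (B z)" for z
  have g: "integrable lborel g"
    unfolding g_def
    by (intro borel_integrable_compact compact continuous_on_compose2[OF continuous_on_box_bubble[of UNIV a]]
        continuous_on_subset[OF inv(2)]) auto
  have nonneg: "0 \<le> box_bubble a (B z)" if "z \<in> T" for z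
    using that unfolding T[symmetric] box_bubble_def
    by (auto simp: inv(1) mem_box_cart intro!: prod_nonneg)
  have gnn: "0 \<le> g z" for z
    using nonneg by (auto simp: g_def indicator_def)
  have "(\<integral>\<^sup>+z. f z \<partial>lborel) = (\<integral>\<^sup>+z. ennreal (g z) \<partial>lborel)"
    by (rule nn_integral_cong) (auto simp: f_def g_def indicator_def)
  also have "\<dots> = ennreal (integral\<^sup>L lborel g)"
    using g gnn by (intro nn_integral_eq_integral) auto
  also have "integral\<^sup>L lborel g = (LINT z:T|lebesgue. box_bubble a (B z))"
    unfolding set_lebesgue_integral_def g_def[symmetric]
    using g by (simp add: integral_completion borel_measurable_integrable)
  finally have f: "(\<integral>\<^sup>+z. f z \<partial>lborel) = ennreal (LINT z:T|lebesgue. box_bubble a (B z))" .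
  have I: "0 \<le> (LINT z:T|lebesgue. box_bubble a (B z))"
    unfolding set_lebesgue_integral_def g_def[symmetric] using gnn by simp
  have T': "(\<integral>\<^sup>+z. indicator T z \<partial>lborel) = ennreal (measure lebesgue T)"
    using emeasure_bounded_finite[OF compact_imp_bounded[OF compact]]
    by (simp add: emeasure_eq_ennreal_measure)
  have box: "(\<integral>\<^sup>+x. indicator T (A x) \<partial>lborel) = ennreal (\<Prod>i\<in>UNIV. a $ i)"
  proof -
    have "(\<integral>\<^sup>+x. indicator T (A x) \<partial>lborel) = (\<integral>\<^sup>+x. indicator (cbox 0 a) x \<partial>lborel)"
      by (rule nn_integral_cong) (simp add: indicator_def mem)
    also have "\<dots> = ennreal (measure lborel (cbox 0 a))"
      by (simp add: emeasure_eq_measure2)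
    also have "measure lborel (cbox 0 a) = (\<Prod>i\<in>UNIV. a $ i)"
      using a by (subst content_cbox_cart) (auto simp: interval_ne_empty_cart less_imp_le)
    finally show ?thesis .
  qed
  have "(\<integral>\<^sup>+x. f (A x) \<partial>lborel) = ennreal (\<Prod>i\<in>UNIV. (a $ i) ^ 3 / 6)"
    unfolding nn_integral_box_bubble[OF a, symmetric] f_def
    by (rule nn_integral_cong) (simp add: indicator_def mem inv(1))
  moreover have "(\<integral>\<^sup>+x. f (A x) \<partial>lborel) * (\<integral>\<^sup>+x. indicator T x \<partial>lborel)
      = (\<integral>\<^sup>+x. indicator T (A x) \<partial>lborel) * (\<integral>\<^sup>+x. f x \<partial>lborel)"
    by (rule nn_integral_affine_ratio[OF shift]) measurable
  ultimately have "ennreal ((\<Prod>i\<in>UNIV. (a $ i) ^ 3 / 6) * measure lebesgue T)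
      = ennreal ((\<Prod>i\<in>UNIV. a $ i) * (LINT z:T|lebesgue. box_bubble a (B z)))"
    using a I by (simp add: f T' box ennreal_mult' prod_nonneg less_imp_le)
  then have "(\<Prod>i\<in>UNIV. (a $ i) ^ 3 / 6) * measure lebesgue T
      = (\<Prod>i\<in>UNIV. a $ i) * (LINT z:T|lebesgue. box_bubble a (B z))"
    using a I by (subst (asm) ennreal_inj) (auto intro!: mult_nonneg_nonneg prod_nonneg simp: less_imp_le)
  moreover have "(\<Prod>i\<in>UNIV. (a $ i) ^ 3 / 6) = (\<Prod>i\<in>UNIV. a $ i) * (\<Prod>i\<in>UNIV. (a $ i)\<^sup>2 / 6)"
    unfolding prod.distrib[symmetric] by (simp add: power2_eq_square power3_eq_cube mult_ac)
  moreover have "(\<Prod>i\<in>UNIV. a $ i) > 0"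
    using a by (intro prod_pos) auto
  ultimately have "(\<Prod>i\<in>UNIV. a $ i) * (LINT z:T|lebesgue. box_bubble a (B z))
      = (\<Prod>i\<in>UNIV. a $ i) * ((\<Prod>i\<in>UNIV. (a $ i)\<^sup>2 / 6) * measure lebesgue T)"
    and "(\<Prod>i\<in>UNIV. a $ i) \<noteq> 0"
    by (simp_all only: mult.assoc order_less_imp_not_eq2 not_False_eq_True)
  then show ?thesis by (metis mult_left_cancel)
qed


text \<open>
  The bubble of an element is given by Hilbert choice. Its defining property can be
  satisfied because the unnormalized bubble has positive integral, and the normalization then
  determines the constant factor.
\<close>

lemma bubble_normal_form:
  fixes T :: "(real^'n) set"
  assumes "reference_map a0 A0 T"
  obtains a A B where "reference_map a A T" "\<And>x. B (A x) = x" "continuous_on UNIV B"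
    "\<And>x. x \<in> cbox 0 a \<Longrightarrow>
       bubble T (A x) = box_bubble a x / ((\<Prod>i\<in>UNIV. (a $ i)\<^sup>2 / 6) * measure lebesgue T)"
    "(LINT x:T|lebesgue. bubble T x) = 1"
proof -
  have mass_pos: "(\<Prod>i\<in>UNIV. (a $ i)\<^sup>2 / 6) * measure lebesgue T > 0"
    if "reference_map a A T" for a A
    using reference_map_image_facts(6)[OF that] that
    unfolding reference_map_def by (auto intro!: mult_pos_pos prod_pos simp: less_imp_neq[symmetric])
  have T_sets: "T \<in> sets lebesgue"
    using lmeasurable_compact reference_map_image_facts(1)[OF assms] by blast
  have "\<exists>b. is_bubble T b"
  proof -
    obtain B where inv: "\<And>x. B (A0 x) = x" "continuous_on UNIV B"
      using reference_map_inverse[OF assms] by metis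
    define q where "q = (\<Prod>i\<in>UNIV. (a0 $ i)\<^sup>2 / 6) * measure lebesgue T"
    have "is_bubble T (\<lambda>z. 1 / q * box_bubble a0 (B z))"
      unfolding is_bubble_def
    proof (intro conjI exI[of _ a0] exI[of _ A0] exI[of _ "1 / q"] ballI)
      show "reference_map a0 A0 T" by fact
      show "(LINT x:T|lebesgue. 1 / q * box_bubble a0 (B x)) = 1"
        using mass_pos[OF assms] integral_mapped_box_bubble[OF assms inv]
        unfolding q_def[symmetric] by simp
    qed (simp add: inv(1) box_bubble_def)
    then show ?thesis by blast
  qed
  then have "is_bubble T (bubble T)"
    unfolding bubble_def by (rule someI_ex)
  then obtain a A c where ref: "reference_map a A T"
    and form: "\<And>x. x \<in> cbox 0 a \<Longrightarrow> bubble T (A x) = c * box_bubble a x"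
    and int: "(LINT x:T|lebesgue. bubble T x) = 1"
    unfolding is_bubble_def box_bubble_def by blast
  obtain B where inv: "\<And>x. B (A x) = x" "continuous_on UNIV B"
    using reference_map_inverse[OF ref] by metis
  have T: "A ` cbox 0 a = T"
    using ref unfolding reference_map_def by auto
  have "(LINT x:T|lebesgue. bubble T x) = (LINT x:T|lebesgue. c * box_bubble a (B x))"
    using T form inv(1) by (intro set_lebesgue_integral_cong T_sets) auto
  then have "c * ((\<Prod>i\<in>UNIV. (a $ i)\<^sup>2 / 6) * measure lebesgue T) = 1"
    using int integral_mapped_box_bubble[OF ref inv] by simp
  then have "c = 1 / ((\<Prod>i\<in>UNIV. (a $ i)\<^sup>2 / 6) * measure lebesgue T)"
    using mass_pos[OF ref] by (metis less_irrefl nonzero_eq_divide_eq)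
  with form have "bubble T (A x) = box_bubble a x / ((\<Prod>i\<in>UNIV. (a $ i)\<^sup>2 / 6) * measure lebesgue T)"
    if "x \<in> cbox 0 a" for x
    using that by simp
  with that[OF ref inv _ int] show thesis by blast
qed

text \<open>
  The upper bound compares each factor with its maximum \<open>s\<^sup>2 / 4 = 3/2 * (s\<^sup>2 / 6)\<close>, attained at
  the midpoint of an edge of length \<open>s\<close>; the factor \<open>s\<^sup>2 / 6\<close> cancels against the normalization.
\<close>

lemma bubble_properties:
  fixes T :: "(real^'n) set"
  assumes "reference_map a0 A0 T"
  shows continuous_on_bubble: "continuous_on T (bubble T)"
    and bubble_nonneg: "x \<in> T \<Longrightarrow> 0 \<le> bubble T x"
    and bubble_le: "x \<in> T \<Longrightarrow> bubble T x \<le> (3 / 2) ^ CARD('n) / measure lebesgue T"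
    and bubble_eq_0: "x \<in> T \<Longrightarrow> x \<notin> interior T \<Longrightarrow> bubble T x = 0"
    and integral_bubble: "(LINT x:T|lebesgue. bubble T x) = 1"
proof -
  obtain a A B where ref: "reference_map a A T" and inv: "\<And>x. B (A x) = x" "continuous_on UNIV B"
    and form: "\<And>x. x \<in> cbox 0 a \<Longrightarrow>
      bubble T (A x) = box_bubble a x / ((\<Prod>i\<in>UNIV. (a $ i)\<^sup>2 / 6) * measure lebesgue T)"
    and int: "(LINT x:T|lebesgue. bubble T x) = 1"
    by (rule bubble_normal_form[OF assms]) (rule that)
  have a: "\<And>i. 0 < a $ i" and T: "A ` cbox 0 a = T"
    using ref unfolding reference_map_def by auto
  have vol: "0 < measure lebesgue T"
    by (rule reference_map_image_facts[OF ref])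
  have prod: "(\<Prod>i\<in>UNIV. (a $ i)\<^sup>2 / 6) > 0"
    using a by (intro prod_pos) (simp add: less_imp_neq[symmetric])
  show "(LINT x:T|lebesgue. bubble T x) = 1" by fact
  have "continuous_on T (\<lambda>z. box_bubble a (B z) / ((\<Prod>i\<in>UNIV. (a $ i)\<^sup>2 / 6) * measure lebesgue T))"
    using vol prod a[THEN less_imp_neq, symmetric]
    by (intro continuous_intros continuous_on_compose2[OF continuous_on_box_bubble[of UNIV a]]
        continuous_on_subset[OF inv(2)]) auto
  then show "continuous_on T (bubble T)"
    by (rule continuous_on_eq) (use T form inv(1) in auto)
  show "0 \<le> bubble T x" if "x \<in> T"
    using that vol prod form unfolding T[symmetric]
    by (auto simp: box_bubble_def mem_box_cart intro!: divide_nonneg_pos prod_nonneg)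
  show "bubble T x \<le> (3 / 2) ^ CARD('n) / measure lebesgue T" if "x \<in> T"
  proof -
    obtain y where y: "y \<in> cbox 0 a" "x = A y"
      using \<open>x \<in> T\<close> unfolding T[symmetric] by blast
    have "box_bubble a y \<le> (\<Prod>i\<in>UNIV. 3 / 2 * ((a $ i)\<^sup>2 / 6))"
      unfolding box_bubble_def
    proof (intro prod_mono conjI)
      fix i
      show "0 \<le> y $ i * (a $ i - y $ i)"
        using y by (auto simp: mem_box_cart)
      have "0 \<le> (y $ i - a $ i / 2)\<^sup>2" by simp
      then show "y $ i * (a $ i - y $ i) \<le> 3 / 2 * ((a $ i)\<^sup>2 / 6)"
        by (simp add: power2_eq_square algebra_simps)
    qed
    also have "\<dots> = (3 / 2) ^ CARD('n) * (\<Prod>i\<in>UNIV. (a $ i)\<^sup>2 / 6)"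
      by (simp only: prod.distrib prod_constant)
    finally show ?thesis
      using vol prod y by (simp add: form field_simps)
  qed
  show "bubble T x = 0" if "x \<in> T" "x \<notin> interior T"
  proof -
    obtain y where y: "y \<in> cbox 0 a" "x = A y"
      using \<open>x \<in> T\<close> unfolding T[symmetric] by blast
    then have "y \<notin> box 0 a"
      using that reference_map_image_facts(5)[OF ref] by blast
    then obtain i where "\<not> (0 < y $ i \<and> y $ i < a $ i)"
      by (auto simp: mem_box_cart)
    moreover have "0 \<le> y $ i" "y $ i \<le> a $ i"
      using y(1) by (auto simp: mem_box_cart)
    ultimately have "y $ i * (a $ i - y $ i) = 0"
      by auto
    then have "box_bubble a y = 0"
      unfolding box_bubble_def by (auto intro: prod_zero)
    then show ?thesis by (simp add: y form)
  qed
qed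

text \<open>
  Both bounds rest on the bubble having integral 1: the upper one multiplies it by the maximum of
  the bubble, the lower one integrates \<open>(b - 1 / |T|)\<^sup>2 \<ge> 0\<close>.
\<close>

lemma integral_bubble_squared_bounds:
  fixes T :: "(real^'n) set"
  assumes ref: "reference_map a A T"
  shows "1 / measure lebesgue T \<le> (LINT x:T|lebesgue. (bubble T x)\<^sup>2)"
    and "(LINT x:T|lebesgue. (bubble T x)\<^sup>2) \<le> (3 / 2) ^ CARD('n) / measure lebesgue T"
proof -
  let ?\<mu> = "measure lebesgue T"
  let ?I = "LINT x:T|lebesgue. (bubble T x)\<^sup>2"
  note [continuous_intros] = continuous_on_bubble[OF ref]
  have compact: "compact T" and vol: "0 < ?\<mu>"
    by (rule reference_map_image_facts[OF ref])+
  have int: "set_integrable lebesgue T f" if "continuous_on T f" for f :: "_ \<Rightarrow> real"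
    using compact that by (rule absolutely_integrable_continuous_compact)
  have meas: "T \<in> sets lebesgue" "emeasure lebesgue T \<noteq> \<infinity>"
    using lmeasurable_compact[OF compact] by (auto simp: fmeasurable_def)
  have "?I \<le> (LINT x:T|lebesgue. (3 / 2) ^ CARD('n) / ?\<mu> * bubble T x)"
  proof (rule set_integral_mono)
    show "(bubble T x)\<^sup>2 \<le> (3 / 2) ^ CARD('n) / ?\<mu> * bubble T x" if "x \<in> T" for x
      unfolding power2_eq_square using bubble_nonneg[OF ref that] bubble_le[OF ref that]
      by (rule mult_right_mono[rotated])
  qed (intro int continuous_intros)+
  also have "\<dots> = (3 / 2) ^ CARD('n) / ?\<mu>"
    by (simp add: integral_bubble[OF ref])
  finally show "?I \<le> (3 / 2) ^ CARD('n) / ?\<mu>" .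
  have "(LINT x:T|lebesgue. 2 / ?\<mu> * bubble T x - 1 / ?\<mu>\<^sup>2) \<le> ?I"
  proof (rule set_integral_mono)
    show "2 / ?\<mu> * bubble T x - 1 / ?\<mu>\<^sup>2 \<le> (bubble T x)\<^sup>2" for x
      using zero_le_power2[of "bubble T x - 1 / ?\<mu>"] vol
      by (simp add: power2_diff power_divide algebra_simps)
  qed (intro int continuous_intros)+
  also have "(LINT x:T|lebesgue. 2 / ?\<mu> * bubble T x - 1 / ?\<mu>\<^sup>2) = 2 / ?\<mu> - ?\<mu> * (1 / ?\<mu>\<^sup>2)"
    by (subst set_integral_diff)
       (use vol in \<open>auto intro!: int continuous_intros simp: integral_bubble[OF ref] set_integral_const[OF meas]\<close>)
  also have "\<dots> = 1 / ?\<mu>"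
    using vol by (simp add: power2_eq_square field_simps)
  finally show "1 / ?\<mu> \<le> ?I" .
qed

section \<open>Integration over a mesh\<close>

text \<open>
  Element boundaries are negligible, being frontiers of convex sets. So the integrand need only
  agree with the continuous functions \<open>g T\<close> on the open elements. This form suits piecewise
  constants, whose values on the element boundaries are arbitrary.
\<close>

lemma integral_mesh:
  fixes f :: "'a::euclidean_space \<Rightarrow> real"
  assumes fin: "finite \<T>"
    and disj: "\<And>S T. S \<in> \<T> \<Longrightarrow> T \<in> \<T> \<Longrightarrow> S \<noteq> T \<Longrightarrow> interior S \<inter> interior T = {}"
    and cv: "\<And>T. T \<in> \<T> \<Longrightarrow> compact T \<and> convex T \<and> interior T \<subseteq> \<Omega>"
    and cover: "\<Omega> \<subseteq> \<Union>\<T>"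
    and cont: "\<And>T. T \<in> \<T> \<Longrightarrow> continuous_on T (g T)"
    and eq: "\<And>T x. T \<in> \<T> \<Longrightarrow> x \<in> interior T \<Longrightarrow> f x = g T x"
  shows "(LINT x:\<Omega>|lebesgue. f x) = (\<Sum>T\<in>\<T>. LINT x:T|lebesgue. g T x)"
proof -
  have null: "negligible (frontier T)" if "T \<in> \<T>" for T
    using cv[OF that] by (intro negligible_convex_frontier) auto
  have sub: "T - interior T \<subseteq> frontier T" for T :: "'a set"
    using closure_subset by (auto simp: frontier_def)
  have int: "set_integrable lebesgue (interior T) f"
    and int_eq: "(LINT x:interior T|lebesgue. f x) = (LINT x:T|lebesgue. g T x)" if "T \<in> \<T>" for T
  proof -
    have gT: "set_integrable lebesgue T (g T)"
      using cv cont that by (intro absolutely_integrable_continuous_compact) auto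
    have neg: "negligible {x \<in> T - interior T. g T x \<noteq> 0}" "negligible {x \<in> interior T - T. g T x \<noteq> 0}"
      using interior_subset[of T] sub[of T] by (auto intro!: negligible_subset[OF null[OF that]])
    have gi: "set_integrable lebesgue (interior T) (g T)"
      by (rule absolutely_integrable_spike_set[OF gT neg])
    then show "set_integrable lebesgue (interior T) f"
      using eq[OF that] by (simp cong: set_integrable_cong)
    have "(LINT x:interior T|lebesgue. f x) = (LINT x:interior T|lebesgue. g T x)"
      using eq[OF that] by (intro set_lebesgue_integral_cong) auto
    also have "\<dots> = integral (interior T) (g T)"
      by (rule set_lebesgue_integral_eq_integral(2)[OF gi])
    also have "\<dots> = integral T (g T)"
      by (rule integral_spike_set[OF neg, symmetric])
    also have "\<dots> = (LINT x:T|lebesgue. g T x)"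
      by (rule set_lebesgue_integral_eq_integral(2)[OF gT, symmetric])
    finally show "(LINT x:interior T|lebesgue. f x) = (LINT x:T|lebesgue. g T x)" .
  qed
  let ?U = "\<Union>T\<in>\<T>. interior T"
  have U: "set_integrable lebesgue ?U f"
    by (intro set_integrable_UN fin int) auto
  have "negligible (\<Union>T\<in>\<T>. frontier T)"
    using fin null by (intro negligible_Union) auto
  moreover have "\<Omega> - ?U \<subseteq> (\<Union>T\<in>\<T>. frontier T)"
    using cover sub by blast
  ultimately have "negligible (\<Omega> - ?U)"
    by (rule negligible_subset)
  then have "negligible {x \<in> \<Omega> - ?U. f x \<noteq> 0}"
    by (rule negligible_subset) auto
  moreover have "{x \<in> ?U - \<Omega>. f x \<noteq> 0} = {}"
    using cv by blast
  then have "negligible {x \<in> ?U - \<Omega>. f x \<noteq> 0}"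
    by (simp only: negligible_empty)
  ultimately have neg: "negligible {x \<in> ?U - \<Omega>. f x \<noteq> 0}" "negligible {x \<in> \<Omega> - ?U. f x \<noteq> 0}"
    by simp_all
  have \<Omega>: "set_integrable lebesgue \<Omega> f"
    by (rule absolutely_integrable_spike_set[OF U neg])
  have "(LINT x:\<Omega>|lebesgue. f x) = (LINT x:?U|lebesgue. f x)"
    by (simp add: set_lebesgue_integral_eq_integral(2)[OF U] set_lebesgue_integral_eq_integral(2)[OF \<Omega>]
        integral_spike_set[OF neg])
  also have "\<dots> = (\<Sum>T\<in>\<T>. LINT x:interior T|lebesgue. f x)"
    by (rule set_integral_finite_Union) (use fin int disj in \<open>auto simp: disjoint_family_on_def\<close>)
  finally show ?thesis
    by (simp add: int_eq)
qed


lemma box_subdivision_elements: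
  fixes \<Omega> :: "(real^'n) set"
  assumes sub: "box_subdivision \<Omega> \<T>" and \<Omega>: "open \<Omega>" "convex \<Omega>" and T: "T \<in> \<T>"
  shows "\<exists>a A. reference_map a A T" "compact T" "convex T" "closure (interior T) = T"
    "T \<subseteq> closure \<Omega>" "interior T \<subseteq> \<Omega>" "0 < measure lebesgue T"
proof -
  show "\<exists>a A. reference_map a A T"
    using sub T unfolding box_subdivision_def by blast
  then obtain a A where ref: "reference_map a A T"
    by blast
  show "compact T" "convex T" "closure (interior T) = T" "0 < measure lebesgue T"
    by (rule reference_map_image_facts[OF ref])+
  show "T \<subseteq> closure \<Omega>"
    using sub T unfolding box_subdivision_def by blast
  then have "interior T \<subseteq> interior (closure \<Omega>)"
    by (rule interior_mono)
  then show "interior T \<subseteq> \<Omega>"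
    using \<Omega> by (simp add: convex_interior_closure interior_open)
qed

text \<open>
  Distinct elements meet only in points that are interior to neither of them, since every point
  of \<open>T\<close> is a limit of interior points of \<open>T\<close>.
\<close>

lemma overlap_not_interior:
  assumes "closure (interior T) = T" "interior S \<inter> interior T = {}" "x \<in> S" "x \<in> T"
  shows "x \<notin> interior S"
proof
  assume "x \<in> interior S"
  moreover have "x \<in> closure (interior T)"
    using assms by simp
  ultimately show False
    using assms(2) open_Int_closure_eq_empty[OF open_interior] by blast
qed

section \<open>Fields made of bubbles\<close>

definition glued_bubbles :: "(real^'n) set set \<Rightarrow> ((real^'n) set \<Rightarrow> real) \<Rightarrow> real^'n \<Rightarrow> real" where
  "glued_bubbles \<T> a x = (\<Sum>T\<in>\<T>. a T * (if x \<in> T then bubble T x else 0))"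

text \<open>
  Where another element overlaps \<open>T\<close>, the bubble of that element vanishes.
\<close>

lemma glued_bubbles_on_element:
  fixes \<Omega> :: "(real^'n) set"
  assumes sub: "box_subdivision \<Omega> \<T>" and \<Omega>: "open \<Omega>" "convex \<Omega>" and T: "T \<in> \<T>" "x \<in> T"
  shows "glued_bubbles \<T> a x = a T * bubble T x"
proof -
  have fin: "finite \<T>"
    using sub unfolding box_subdivision_def by blast
  have "bubble S x = 0" if "S \<in> \<T>" "S \<noteq> T" "x \<in> S" for S
  proof -
    have "interior S \<inter> interior T = {}"
      using sub that T unfolding box_subdivision_def by blast
    then have "x \<notin> interior S"
      using overlap_not_interior box_subdivision_elements(4)[OF sub \<Omega>] T that by blast
    then show ?thesis
      using box_subdivision_elements(1)[OF sub \<Omega> \<open>S \<in> \<T>\<close>] bubble_eq_0 \<open>x \<in> S\<close> by blast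
  qed
  then have "glued_bubbles \<T> a x = (\<Sum>S\<in>\<T>. if S = T then a T * bubble T x else 0)"
    unfolding glued_bubbles_def using T by (intro sum.cong) auto
  also have "\<dots> = a T * bubble T x"
    using fin T by (simp add: sum.delta)
  finally show ?thesis .
qed

text \<open>
  Open elements lie inside the open domain, so a point of its frontier is interior to no element.
\<close>

lemma glued_bubbles_frontier:
  fixes \<Omega> :: "(real^'n) set"
  assumes sub: "box_subdivision \<Omega> \<T>" and \<Omega>: "open \<Omega>" "convex \<Omega>" and x: "x \<in> frontier \<Omega>"
  shows "glued_bubbles \<T> a x = 0"
  unfolding glued_bubbles_def
proof (intro sum.neutral ballI)
  fix T assume T: "T \<in> \<T>"
  have "x \<notin> interior T"
    using x box_subdivision_elements(6)[OF sub \<Omega> T] \<Omega>(1) by (auto simp: frontier_def interior_open)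
  moreover obtain b A where ref: "reference_map b A T"
    using box_subdivision_elements(1)[OF sub \<Omega> T] by blast
  ultimately show "a T * (if x \<in> T then bubble T x else 0) = 0"
    by (simp add: bubble_eq_0[OF ref])
qed

text \<open>
  A bubble vanishes on the frontier of its element, so its extension by zero is continuous.
\<close>

lemma continuous_on_glued_bubbles:
  fixes \<Omega> :: "(real^'n) set"
  assumes sub: "box_subdivision \<Omega> \<T>" and \<Omega>: "open \<Omega>" "convex \<Omega>"
  shows "continuous_on S (glued_bubbles \<T> a)"
proof -
  have "continuous_on UNIV (\<lambda>x. if x \<in> T then bubble T x else 0)" if T: "T \<in> \<T>" for T
  proof -
    obtain a A where ref: "reference_map a A T"
      using box_subdivision_elements(1)[OF sub \<Omega> T] by blast
    have "closed T"
      using box_subdivision_elements(2)[OF sub \<Omega> T] by (rule compact_imp_closed)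
    then have "continuous_on (T \<union> - interior T) (\<lambda>x. if x \<in> T then bubble T x else 0)"
      by (intro continuous_on_If continuous_on_bubble[OF ref] continuous_on_const)
         (auto intro: bubble_eq_0[OF ref])
    moreover have "T \<union> - interior T = UNIV"
      using interior_subset by blast
    ultimately show ?thesis by simp
  qed
  then have "continuous_on UNIV (glued_bubbles \<T> a)"
    unfolding glued_bubbles_def by (intro continuous_intros) auto
  then show ?thesis
    by (rule continuous_on_subset) simp
qed

lemma glued_bubbles_in_V_space:
  fixes \<Omega> :: "(real^'n) set"
  assumes sub: "box_subdivision \<Omega> \<T>" and \<Omega>: "open \<Omega>" "convex \<Omega>"
    and n: "continuous_on (closure \<Omega>) n"
  shows "(\<lambda>x. glued_bubbles \<T> a x *\<^sub>R n x) \<in> V_space \<Omega> \<T> n m"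
proof -
  let ?v = "\<lambda>x. glued_bubbles \<T> a x *\<^sub>R n x"
  have "?v \<in> V_bubble \<Omega> \<T> n"
    unfolding V_bubble_def mem_Collect_eq
  proof (intro conjI ballI exI)
    show "continuous_on (closure \<Omega>) ?v"
      by (intro continuous_on_scaleR continuous_on_glued_bubbles[OF sub \<Omega>] n)
    show "?v x = 0" if "x \<in> frontier \<Omega>" for x
      by (simp add: glued_bubbles_frontier[OF sub \<Omega> that])
    show "?v x = (a T * bubble T x) *\<^sub>R n x" if "T \<in> \<T>" "x \<in> T" for T x
      by (simp add: glued_bubbles_on_element[OF sub \<Omega> that])
  qed
  moreover have "(\<lambda>x. 0) \<in> Q_space3 \<Omega> \<T> m"
  proof -
    have "(\<lambda>x :: real^'n. 0 :: real) \<in> tensor_polynomials m"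
      unfolding tensor_polynomials_def mem_Collect_eq by (intro exI[of _ "\<lambda>e. 0"]) simp
    then have "(\<lambda>x. 0) \<in> Q_space \<Omega> \<T> m"
      using box_subdivision_elements(1)[OF sub \<Omega>] unfolding Q_space_def mem_Collect_eq
      by (intro conjI ballI continuous_on_const) metis
    then show ?thesis
      unfolding Q_space3_def by simp
  qed
  ultimately show ?thesis
    unfolding V_space_def mem_Collect_eq
    by (intro conjI bexI[of _ "\<lambda>x. 0"] bexI[of _ ?v])
       (simp_all add: glued_bubbles_frontier[OF sub \<Omega>])
qed

lemma continuous_on_Q_space3:
  assumes "n \<in> Q_space3 \<Omega> \<T> p"
  shows "continuous_on (closure \<Omega>) n"
proof -
  have "continuous_on (closure \<Omega>) (\<lambda>x. \<chi> k. n x $ k)"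
    using assms unfolding Q_space3_def Q_space_def by (intro continuous_on_vec_lambda) auto
  then show ?thesis by simp
qed

lemma L2_norm_on_power2: "(L2_norm_on \<Omega> u)\<^sup>2 = (LINT x:\<Omega>|lebesgue. (norm (u x))\<^sup>2)"
  unfolding L2_norm_on_def set_lebesgue_integral_def by (simp add: integral_nonneg_AE)

lemma L2_norm_on_nonneg: "0 \<le> L2_norm_on \<Omega> u"
  unfolding L2_norm_on_def set_lebesgue_integral_def by (simp add: integral_nonneg_AE)

lemma L2_norm_le_DC_norm: "L2_norm_on \<Omega> v \<le> DC_norm \<Omega> \<iota> v"
  unfolding DC_norm_def by (rule real_le_rsqrt) simp

lemma integral_mesh_box_subdivision:
  fixes \<Omega> :: "(real^'n) set" and f :: "real^'n \<Rightarrow> real"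
  assumes sub: "box_subdivision \<Omega> \<T>" and \<Omega>: "open \<Omega>" "convex \<Omega>"
    and cont: "\<And>T. T \<in> \<T> \<Longrightarrow> continuous_on T (g T)"
    and eq: "\<And>T x. T \<in> \<T> \<Longrightarrow> x \<in> interior T \<Longrightarrow> f x = g T x"
  shows "(LINT x:\<Omega>|lebesgue. f x) = (\<Sum>T\<in>\<T>. LINT x:T|lebesgue. g T x)"
proof (rule integral_mesh)
  show "continuous_on T (g T)" if "T \<in> \<T>" for T
    using that by (rule cont)
  show "f x = g T x" if "T \<in> \<T>" "x \<in> interior T" for T x
    using that by (rule eq)
  show "finite \<T>" "\<Omega> \<subseteq> \<Union>\<T>"
    using sub closure_subset unfolding box_subdivision_def by auto
  show "interior S \<inter> interior T = {}" if "S \<in> \<T>" "T \<in> \<T>" "S \<noteq> T" for S T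
    using sub that unfolding box_subdivision_def by blast
  show "compact T \<and> convex T \<and> interior T \<subseteq> \<Omega>" if "T \<in> \<T>" for T
    using box_subdivision_elements[OF sub \<Omega> that] by blast
qed

lemma L2_norm_P0:
  fixes \<Omega> :: "(real^'n) set" and \<gamma> :: "real^'n \<Rightarrow> real"
  assumes sub: "box_subdivision \<Omega> \<T>" and \<Omega>: "open \<Omega>" "convex \<Omega>"
    and g: "\<And>T x. T \<in> \<T> \<Longrightarrow> x \<in> interior T \<Longrightarrow> \<gamma> x = g T"
  shows "(L2_norm_on \<Omega> \<gamma>)\<^sup>2 = (\<Sum>T\<in>\<T>. (g T)\<^sup>2 * measure lebesgue T)"
proof -
  have "(L2_norm_on \<Omega> \<gamma>)\<^sup>2 = (\<Sum>T\<in>\<T>. LINT x:T|lebesgue. (g T)\<^sup>2)"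
    unfolding L2_norm_on_power2 by (rule integral_mesh_box_subdivision[OF sub \<Omega>]) (auto simp: g)
  also have "\<dots> = (\<Sum>T\<in>\<T>. (g T)\<^sup>2 * measure lebesgue T)"
  proof (rule sum.cong)
    fix T assume "T \<in> \<T>"
    then have "T \<in> lmeasurable"
      by (intro lmeasurable_compact box_subdivision_elements(2)[OF sub \<Omega>])
    from fmeasurableD[OF this] fmeasurableD2[OF this]
    show "(LINT x:T|lebesgue. (g T)\<^sup>2) = (g T)\<^sup>2 * measure lebesgue T"
      by (simp add: set_integral_const)
  qed simp
  finally show ?thesis .
qed

text \<open>
  Bubbles of distinct elements do not interact, and on one element the bounds for \<open>n\<close> reduce the
  integral to that of the squared bubble.
\<close>

lemma L2_norm_bubble_field:
  fixes \<Omega> :: "(real^'n) set" and n :: "real^'n \<Rightarrow> real^3" and a :: "(real^'n) set \<Rightarrow> real"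
  assumes sub: "box_subdivision \<Omega> \<T>" and \<Omega>: "open \<Omega>" "convex \<Omega>"
    and n: "continuous_on (closure \<Omega>) n"
    and bounds: "0 \<le> \<alpha>" "0 \<le> \<beta>" "\<And>x. x \<in> \<Omega> \<Longrightarrow> \<alpha> \<le> (norm (n x))\<^sup>2 \<and> (norm (n x))\<^sup>2 \<le> \<beta>"
  defines "v \<equiv> \<lambda>x. glued_bubbles \<T> a x *\<^sub>R n x"
  shows "\<alpha> * (\<Sum>T\<in>\<T>. (a T)\<^sup>2 / measure lebesgue T) \<le> (L2_norm_on \<Omega> v)\<^sup>2" (is ?lower)
    and "(L2_norm_on \<Omega> v)\<^sup>2 \<le> \<beta> * (3 / 2) ^ CARD('n) * (\<Sum>T\<in>\<T>. (a T)\<^sup>2 / measure lebesgue T)" (is ?upper)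
proof -
  let ?I = "\<lambda>T. LINT x:T|lebesgue. (bubble T x)\<^sup>2 * (norm (n x))\<^sup>2"
  have cont: "continuous_on T (bubble T)" "continuous_on T n" if "T \<in> \<T>" for T
    using box_subdivision_elements(1)[OF sub \<Omega> that] continuous_on_bubble
      continuous_on_subset[OF n box_subdivision_elements(5)[OF sub \<Omega> that]] by blast+
  have "(L2_norm_on \<Omega> v)\<^sup>2
      = (\<Sum>T\<in>\<T>. LINT x:T|lebesgue. (a T)\<^sup>2 * ((bubble T x)\<^sup>2 * (norm (n x))\<^sup>2))"
    unfolding L2_norm_on_power2
  proof (rule integral_mesh_box_subdivision[OF sub \<Omega>])
    show "(norm (v x))\<^sup>2 = (a T)\<^sup>2 * ((bubble T x)\<^sup>2 * (norm (n x))\<^sup>2)"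
      if "T \<in> \<T>" "x \<in> interior T" for T x
      using glued_bubbles_on_element[OF sub \<Omega> \<open>T \<in> \<T>\<close>, of x a] that interior_subset[of T]
      by (auto simp: v_def power_mult_distrib)
  qed (intro continuous_intros cont)
  then have L2: "(L2_norm_on \<Omega> v)\<^sup>2 = (\<Sum>T\<in>\<T>. (a T)\<^sup>2 * ?I T)"
    by simp
  have I: "\<alpha> * (1 / measure lebesgue T) \<le> ?I T"
    "?I T \<le> \<beta> * ((3 / 2) ^ CARD('n) / measure lebesgue T)" if T: "T \<in> \<T>" for T
  proof -
    obtain b A where ref: "reference_map b A T"
      using box_subdivision_elements(1)[OF sub \<Omega> T] by blast
    have int: "set_integrable lebesgue T f" if "continuous_on T f" for f :: "_ \<Rightarrow> real"
      using box_subdivision_elements(2)[OF sub \<Omega> T] that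
      by (rule absolutely_integrable_continuous_compact)
    (* The bounds on n are only given on the open domain, but the bubble vanishes elsewhere on T. *)
    have pointwise: "\<alpha> * (bubble T x)\<^sup>2 \<le> (bubble T x)\<^sup>2 * (norm (n x))\<^sup>2"
      "(bubble T x)\<^sup>2 * (norm (n x))\<^sup>2 \<le> \<beta> * (bubble T x)\<^sup>2" if "x \<in> T" for x
    proof -
      have "bubble T x = 0 \<or> x \<in> \<Omega>"
        using bubble_eq_0[OF ref that] box_subdivision_elements(6)[OF sub \<Omega> T] by blast
      then show "\<alpha> * (bubble T x)\<^sup>2 \<le> (bubble T x)\<^sup>2 * (norm (n x))\<^sup>2"
        "(bubble T x)\<^sup>2 * (norm (n x))\<^sup>2 \<le> \<beta> * (bubble T x)\<^sup>2"
        using bounds(3)[of x] by (auto simp: mult.commute[of "(bubble T x)\<^sup>2"] intro: mult_right_mono)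
    qed
    have "\<alpha> * (1 / measure lebesgue T) \<le> \<alpha> * (LINT x:T|lebesgue. (bubble T x)\<^sup>2)"
      by (rule mult_left_mono[OF integral_bubble_squared_bounds(1)[OF ref] bounds(1)])
    also have "\<dots> = (LINT x:T|lebesgue. \<alpha> * (bubble T x)\<^sup>2)"
      by simp
    also have "\<dots> \<le> ?I T"
      by (rule set_integral_mono[OF _ _ pointwise(1)]) (intro int continuous_intros cont T)+
    finally show "\<alpha> * (1 / measure lebesgue T) \<le> ?I T" .
    have "?I T \<le> (LINT x:T|lebesgue. \<beta> * (bubble T x)\<^sup>2)"
      by (rule set_integral_mono[OF _ _ pointwise(2)]) (intro int continuous_intros cont T)+
    also have "\<dots> = \<beta> * (LINT x:T|lebesgue. (bubble T x)\<^sup>2)"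
      by simp
    also have "\<dots> \<le> \<beta> * ((3 / 2) ^ CARD('n) / measure lebesgue T)"
      by (rule mult_left_mono[OF integral_bubble_squared_bounds(2)[OF ref] bounds(2)])
    finally show "?I T \<le> \<beta> * ((3 / 2) ^ CARD('n) / measure lebesgue T)" .
  qed
  have "\<alpha> * (\<Sum>T\<in>\<T>. (a T)\<^sup>2 / measure lebesgue T)
      = (\<Sum>T\<in>\<T>. (a T)\<^sup>2 * (\<alpha> * (1 / measure lebesgue T)))"
    by (simp add: sum_distrib_left mult_ac)
  also have "\<dots> \<le> (L2_norm_on \<Omega> v)\<^sup>2"
    unfolding L2 by (intro sum_mono mult_left_mono I) auto
  finally show ?lower .
  have "(L2_norm_on \<Omega> v)\<^sup>2 \<le> (\<Sum>T\<in>\<T>. (a T)\<^sup>2 * (\<beta> * ((3 / 2) ^ CARD('n) / measure lebesgue T)))"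
    unfolding L2 by (intro sum_mono mult_left_mono I) auto
  also have "\<dots> = \<beta> * (3 / 2) ^ CARD('n) * (\<Sum>T\<in>\<T>. (a T)\<^sup>2 / measure lebesgue T)"
    by (simp add: sum_distrib_left mult_ac)
  finally show ?upper .
qed

text \<open>
  The sign condition makes every element contribute a nonnegative amount, so that the lower bound
  for \<open>n\<close> can be used on each of them.
\<close>

lemma b_form_bubble_field:
  fixes \<Omega> :: "(real^'n) set" and n :: "real^'n \<Rightarrow> real^3" and a :: "(real^'n) set \<Rightarrow> real"
  assumes sub: "box_subdivision \<Omega> \<T>" and \<Omega>: "open \<Omega>" "convex \<Omega>"
    and n: "continuous_on (closure \<Omega>) n"
    and lower: "\<And>x. x \<in> \<Omega> \<Longrightarrow> \<alpha> \<le> (norm (n x))\<^sup>2"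
    and g: "\<And>T x. T \<in> \<T> \<Longrightarrow> x \<in> interior T \<Longrightarrow> \<gamma> x = g T"
    and sign: "\<And>T. T \<in> \<T> \<Longrightarrow> 0 \<le> g T * a T"
  shows "\<alpha> * (\<Sum>T\<in>\<T>. g T * a T) \<le> b_form \<Omega> n (\<lambda>x. glued_bubbles \<T> a x *\<^sub>R n x) \<gamma>"
proof -
  let ?I = "\<lambda>T. LINT x:T|lebesgue. bubble T x * (norm (n x))\<^sup>2"
  have cont: "continuous_on T (bubble T)" "continuous_on T n" if "T \<in> \<T>" for T
    using box_subdivision_elements(1)[OF sub \<Omega> that] continuous_on_bubble
      continuous_on_subset[OF n box_subdivision_elements(5)[OF sub \<Omega> that]] by blast+
  have "b_form \<Omega> n (\<lambda>x. glued_bubbles \<T> a x *\<^sub>R n x) \<gamma>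
      = (\<Sum>T\<in>\<T>. LINT x:T|lebesgue. g T * a T * (bubble T x * (norm (n x))\<^sup>2))"
    unfolding b_form_def
  proof (rule integral_mesh_box_subdivision[OF sub \<Omega>])
    show "\<gamma> x * (n x \<bullet> (glued_bubbles \<T> a x *\<^sub>R n x)) = g T * a T * (bubble T x * (norm (n x))\<^sup>2)"
      if "T \<in> \<T>" "x \<in> interior T" for T x
      using glued_bubbles_on_element[OF sub \<Omega> \<open>T \<in> \<T>\<close>, of x a] that interior_subset[of T] g[OF that]
      by (auto simp: power2_norm_eq_inner)
  qed (intro continuous_intros cont)
  then have b: "b_form \<Omega> n (\<lambda>x. glued_bubbles \<T> a x *\<^sub>R n x) \<gamma> = (\<Sum>T\<in>\<T>. g T * a T * ?I T)"
    by simp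
  have I: "\<alpha> \<le> ?I T" if T: "T \<in> \<T>" for T
  proof -
    obtain b A where ref: "reference_map b A T"
      using box_subdivision_elements(1)[OF sub \<Omega> T] by blast
    have int: "set_integrable lebesgue T f" if "continuous_on T f" for f :: "_ \<Rightarrow> real"
      using box_subdivision_elements(2)[OF sub \<Omega> T] that
      by (rule absolutely_integrable_continuous_compact)
    have pointwise: "\<alpha> * bubble T x \<le> bubble T x * (norm (n x))\<^sup>2" if "x \<in> T" for x
    proof -
      have "bubble T x = 0 \<or> x \<in> \<Omega>"
        using bubble_eq_0[OF ref that] box_subdivision_elements(6)[OF sub \<Omega> T] by blast
      then show ?thesis
        using lower[of x] bubble_nonneg[OF ref that]
        by (auto simp: mult.commute[of "bubble T x"] intro: mult_right_mono)
    qed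
    have "\<alpha> = (LINT x:T|lebesgue. \<alpha> * bubble T x)"
      by (simp add: integral_bubble[OF ref])
    also have "\<dots> \<le> ?I T"
      by (rule set_integral_mono[OF _ _ pointwise]) (intro int continuous_intros cont T)+
    finally show ?thesis .
  qed
  have "\<alpha> * (\<Sum>T\<in>\<T>. g T * a T) = (\<Sum>T\<in>\<T>. g T * a T * \<alpha>)"
    by (simp add: sum_distrib_left mult.commute)
  also have "\<dots> \<le> (\<Sum>T\<in>\<T>. g T * a T * ?I T)"
    by (intro sum_mono mult_left_mono I sign)
  finally show ?thesis
    unfolding b .
qed

text \<open>
  The ball in an element \<open>T\<close> is no wider than \<open>T\<close>:
  \<open>\<rho> h diam \<Omega> \<le> diam B \<le> diam T \<le> h diam \<Omega>\<close>.
\<close>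

lemma quasi_uniformity_le_1:
  fixes \<Omega> :: "(real^'n) set"
  assumes \<Omega>: "polyhedral_domain \<Omega>" and qu: "quasi_uniform_family \<Omega> \<rho> \<T>" and h: "0 < h" "h \<le> 1"
  shows "\<rho> \<le> 1" "\<T> h \<noteq> {}"
proof -
  have sub: "box_subdivision \<Omega> (\<T> h)"
    and dT: "\<And>T. T \<in> \<T> h \<Longrightarrow> diameter T \<le> h * diameter \<Omega>"
    and dB: "\<And>T. T \<in> \<T> h \<Longrightarrow> \<exists>B. largest_star_ball T B \<and> \<rho> * h * diameter \<Omega> \<le> diameter B"
    using qu h unfolding quasi_uniform_family_def by auto
  have ne: "\<Omega> \<noteq> {}" and op: "open \<Omega>" and cv: "convex \<Omega>"
    using \<Omega> unfolding polyhedral_domain_def by auto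
  show "\<T> h \<noteq> {}"
    using sub ne unfolding box_subdivision_def by (metis Union_empty closure_eq_empty)
  then obtain T where T: "T \<in> \<T> h" by blast
  obtain z r where B: "0 < r" "ball z r \<subseteq> T" "\<rho> * h * diameter \<Omega> \<le> diameter (ball z r)"
    using dB[OF T] unfolding largest_star_ball_def star_ball_def by blast
  have "diameter (ball z r) \<le> diameter T"
    using B(2) compact_imp_bounded[OF box_subdivision_elements(2)[OF sub op cv T]]
    by (rule diameter_subset)
  with B dT[OF T] have "\<rho> * (h * diameter \<Omega>) \<le> 1 * (h * diameter \<Omega>)" "0 < h * diameter \<Omega>"
    by (simp_all add: mult.assoc)
  then show "\<rho> \<le> 1"
    by (simp only: mult_le_cancel_right_pos)
qed

section \<open>The inf-sup condition\<close>

theorem lemma3p12: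
  fixes \<Omega> :: "(real^'n) set" and \<iota> :: "'n \<Rightarrow> 3"
    and \<T> :: "real \<Rightarrow> (real^'n) set set"
    and n\<^sub>k :: "real^'n \<Rightarrow> real^3"
    and \<rho> \<alpha> \<beta> K\<^sub>2 K\<^sub>3 \<kappa> C\<^sub>d C\<^sub>f C\<^sub>s h \<zeta> :: real
    and p m :: nat
  assumes "axis_labelling \<iota>"
    and "polyhedral_domain \<Omega>"
    and "quasi_uniform_family \<Omega> \<rho> \<T>"
    and "0 < h" "h \<le> 1"
    and "1 \<le> p" "n\<^sub>k \<in> Q_space3 \<Omega> (\<T> h) p"
    and "0 < \<alpha>" "\<alpha> \<le> 1" "1 \<le> \<beta>"
    and "\<And>x. x \<in> \<Omega> \<Longrightarrow> \<alpha> \<le> (norm (n\<^sub>k x))\<^sup>2 \<and> (norm (n\<^sub>k x))\<^sup>2 \<le> \<beta>"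
    and "0 < K\<^sub>2" "0 < K\<^sub>3" "\<kappa> = K\<^sub>2 / K\<^sub>3"
    and "uniformly_spd \<Omega> (\<lambda>x. mat 1 - (1 - \<kappa>) *\<^sub>R outer_product (n\<^sub>k x) (n\<^sub>k x))"
    and "1 \<le> m"
    and "C\<^sub>d = (3 / 2) ^ CARD('n)"
    and "0 < C\<^sub>s"
    and "\<And>v. v \<in> V_space \<Omega> (\<T> h) n\<^sub>k m \<Longrightarrow>
               H1_norm \<Omega> \<iota> v \<le> C\<^sub>s * inverse h * L2_norm_on \<Omega> v"
    and "0 < C\<^sub>f"
    and "\<And>v. v \<in> V_space \<Omega> (\<T> h) n\<^sub>k m \<Longrightarrow> DC_norm \<Omega> \<iota> v \<le> C\<^sub>f * H1_norm \<Omega> \<iota> v"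
    and "\<zeta> = h * (2 * \<alpha> * \<rho> ^ CARD('n) / (9 * C\<^sub>f * C\<^sub>s * sqrt (\<beta> * C\<^sub>d)))"
  shows "\<forall>\<gamma>\<in>P0_space (\<T> h).
           ereal (\<zeta> * L2_norm_on \<Omega> \<gamma>)
           \<le> (SUP v\<in>{v \<in> V_space \<Omega> (\<T> h) n\<^sub>k m. \<exists>x\<in>\<Omega>. v x \<noteq> 0}.
                 ereal (\<bar>b_form \<Omega> n\<^sub>k v \<gamma>\<bar> / DC_norm \<Omega> \<iota> v))"
proof
  fix \<gamma> assume "\<gamma> \<in> P0_space (\<T> h)"
  then obtain g where g: "\<And>T x. T \<in> \<T> h \<Longrightarrow> x \<in> interior T \<Longrightarrow> \<gamma> x = g T"
    unfolding P0_space_def by simp metis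
  have \<Omega>: "open \<Omega>" "convex \<Omega>"
    using assms(2) unfolding polyhedral_domain_def by auto
  have sub: "box_subdivision \<Omega> (\<T> h)" and "0 < \<rho>"
    using assms(3-5) unfolding quasi_uniform_family_def by auto
  have n: "continuous_on (closure \<Omega>) n\<^sub>k"
    using assms(7) by (rule continuous_on_Q_space3)
  have \<rho>: "\<rho> \<le> 1" and ne: "\<T> h \<noteq> {}"
    using quasi_uniformity_le_1[OF assms(2-5)] by auto
  have fin: "finite (\<T> h)"
    using sub unfolding box_subdivision_def by blast
  have vol: "0 < measure lebesgue T" if "T \<in> \<T> h" for T
    using box_subdivision_elements(7)[OF sub \<Omega> that] .
  let ?G = "L2_norm_on \<Omega> \<gamma>"
  have G2: "?G\<^sup>2 = (\<Sum>T\<in>\<T> h. (g T)\<^sup>2 * measure lebesgue T)"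
    by (rule L2_norm_P0[OF sub \<Omega> g])
  define v where "v a x = glued_bubbles (\<T> h) a x *\<^sub>R n\<^sub>k x" for a x
  have v: "v a \<in> V_space \<Omega> (\<T> h) n\<^sub>k m" for a
    unfolding v_def by (rule glued_bubbles_in_V_space[OF sub \<Omega> n])
  note L2_v = L2_norm_bubble_field[OF sub \<Omega> n less_imp_le[OF assms(8)] order_trans[OF zero_le_one assms(10)]
      assms(11), folded v_def]
  have v_pos: "0 < L2_norm_on \<Omega> (v a)" "\<exists>x\<in>\<Omega>. v a x \<noteq> 0"
    if "T \<in> \<T> h" "a T \<noteq> 0" for a T
  proof -
    have "0 < (\<Sum>T\<in>\<T> h. (a T)\<^sup>2 / measure lebesgue T)"
      using fin vol that by (intro sum_pos2[of _ T]) (auto simp: less_imp_le)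
    with assms(8) have "0 < \<alpha> * (\<Sum>T\<in>\<T> h. (a T)\<^sup>2 / measure lebesgue T)"
      by simp
    also have "\<dots> \<le> (L2_norm_on \<Omega> (v a))\<^sup>2"
      by (rule L2_v(1))
    finally show pos: "0 < L2_norm_on \<Omega> (v a)"
      using L2_norm_on_nonneg[of \<Omega> "v a"] by (cases "L2_norm_on \<Omega> (v a) = 0") auto
    show "\<exists>x\<in>\<Omega>. v a x \<noteq> 0"
    proof (rule ccontr)
      assume "\<not> ?thesis"
      then have "L2_norm_on \<Omega> (v a) = (L2_norm_on \<Omega> (\<lambda>x. 0 :: real^3))"
        using \<Omega>(1) unfolding L2_norm_on_def by (intro arg_cong[of _ _ sqrt] set_lebesgue_integral_cong) auto
      then show False
        using pos by (simp add: L2_norm_on_def set_lebesgue_integral_def)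
    qed
  qed
  have "\<exists>w. w \<in> V_space \<Omega> (\<T> h) n\<^sub>k m \<and> (\<exists>x\<in>\<Omega>. w x \<noteq> 0)
      \<and> \<zeta> * ?G \<le> \<bar>b_form \<Omega> n\<^sub>k w \<gamma>\<bar> / DC_norm \<Omega> \<iota> w"
  proof (cases "?G = 0")
    case True
    (* The left-hand side is 0 and the ratios are nonnegative, so any test field works; but one
       has to exist, as the supremum of the empty set is -infinity. *)
    obtain T where "T \<in> \<T> h"
      using ne by blast
    then have "\<exists>x\<in>\<Omega>. v (\<lambda>T. 1) x \<noteq> 0" "0 < DC_norm \<Omega> \<iota> (v (\<lambda>T. 1))"
      using v_pos[of T "\<lambda>T. 1"] L2_norm_le_DC_norm[of \<Omega> "v (\<lambda>T. 1)" \<iota>] by auto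
    with v True show ?thesis
      by (intro exI[of _ "v (\<lambda>T. 1)"]) auto
  next
    case False
    (* The weight |T| makes both the form and the squared norm of the test field comparable
       to the squared norm of gamma. *)
    define a where "a T = g T * measure lebesgue T" for T
    define w where "w = v a"
    have G: "0 < ?G"
      using False L2_norm_on_nonneg[of \<Omega> \<gamma>] by simp
    obtain T where T: "T \<in> \<T> h" "g T \<noteq> 0"
    proof (rule ccontr)
      assume "\<not> thesis"
      with that have "\<And>T. T \<in> \<T> h \<Longrightarrow> g T = 0" by blast
      then have "?G\<^sup>2 = 0" unfolding G2 by (simp add: sum.neutral)
      with False show False by simp
    qed
    then have "a T \<noteq> 0"
      using vol[of T] by (simp add: a_def)
    note w_pos = v_pos[of T a, OF T(1) this, folded w_def]
    have "(\<Sum>T\<in>\<T> h. (a T)\<^sup>2 / measure lebesgue T) = ?G\<^sup>2"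
      unfolding G2 using vol
      by (intro sum.cong) (auto simp: a_def power2_eq_square)
    then have "(L2_norm_on \<Omega> w)\<^sup>2 \<le> \<beta> * C\<^sub>d * ?G\<^sup>2"
      using L2_v(2)[of a] by (simp add: w_def assms(17))
    then have "sqrt ((L2_norm_on \<Omega> w)\<^sup>2) \<le> sqrt (\<beta> * C\<^sub>d * ?G\<^sup>2)"
      by (rule real_sqrt_le_mono)
    then have L2_w: "L2_norm_on \<Omega> w \<le> sqrt (\<beta> * C\<^sub>d) * ?G"
      using G L2_norm_on_nonneg[of \<Omega> w] by (simp add: real_sqrt_mult)
    have "\<alpha> * (\<Sum>T\<in>\<T> h. g T * a T) \<le> b_form \<Omega> n\<^sub>k w \<gamma>"
      unfolding w_def v_def
      using vol assms(11)
      by (intro b_form_bubble_field[OF sub \<Omega> n _ g]) (auto simp: a_def mult.assoc[symmetric] less_imp_le)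
    moreover have "(\<Sum>T\<in>\<T> h. g T * a T) = ?G\<^sup>2"
      unfolding G2 a_def by (simp add: power2_eq_square mult.assoc)
    ultimately have b: "\<alpha> * ?G\<^sup>2 \<le> \<bar>b_form \<Omega> n\<^sub>k w \<gamma>\<bar>"
      by simp
    let ?S = "sqrt (\<beta> * C\<^sub>d)"
    have S: "0 < ?S"
      using assms(10,17) by simp
    have w: "w \<in> V_space \<Omega> (\<T> h) n\<^sub>k m"
      unfolding w_def by (rule v)
    have "DC_norm \<Omega> \<iota> w \<le> C\<^sub>f * H1_norm \<Omega> \<iota> w"
      by (rule assms(21)[OF w])
    also have "\<dots> \<le> C\<^sub>f * (C\<^sub>s * inverse h * L2_norm_on \<Omega> w)"
      using assms(20) by (intro mult_left_mono assms(19)[OF w]) simp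
    also have "\<dots> \<le> C\<^sub>f * (C\<^sub>s * inverse h * (?S * ?G))"
      using assms(4,18,20) by (intro mult_left_mono L2_w) auto
    finally have DC: "DC_norm \<Omega> \<iota> w \<le> C\<^sub>f * (C\<^sub>s * inverse h * (?S * ?G))" .
    have DC_pos: "0 < DC_norm \<Omega> \<iota> w"
      using w_pos(1) L2_norm_le_DC_norm[of \<Omega> w \<iota>] by simp
    have "\<rho> ^ CARD('n) \<le> 1"
      using \<open>0 < \<rho>\<close> \<rho> by (simp add: power_le_one)
    then have "\<zeta> \<le> h * (\<alpha> / (C\<^sub>f * C\<^sub>s * ?S))"
      unfolding assms(22) using assms(4,8,18,20) S
      by (intro mult_left_mono) (auto simp: field_simps)
    then have "\<zeta> * ?G \<le> h * (\<alpha> / (C\<^sub>f * C\<^sub>s * ?S)) * ?G"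
      using G by (intro mult_right_mono) auto
    also have "\<dots> = \<alpha> * ?G\<^sup>2 / (C\<^sub>f * (C\<^sub>s * inverse h * (?S * ?G)))"
      using G assms(4,18,20) S by (simp add: field_simps power2_eq_square)
    also have "\<dots> \<le> \<bar>b_form \<Omega> n\<^sub>k w \<gamma>\<bar> / DC_norm \<Omega> \<iota> w"
      using b DC DC_pos by (intro frac_le) auto
    finally show ?thesis
      using w w_pos(2) by blast
  qed
  then obtain w where w: "w \<in> {v \<in> V_space \<Omega> (\<T> h) n\<^sub>k m. \<exists>x\<in>\<Omega>. v x \<noteq> 0}"
    and le: "\<zeta> * ?G \<le> \<bar>b_form \<Omega> n\<^sub>k w \<gamma>\<bar> / DC_norm \<Omega> \<iota> w"
    by blast
  show "ereal (\<zeta> * ?G) \<le> (SUP v\<in>{v \<in> V_space \<Omega> (\<T> h) n\<^sub>k m. \<exists>x\<in>\<Omega>. v x \<noteq> 0}.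
      ereal (\<bar>b_form \<Omega> n\<^sub>k v \<gamma>\<bar> / DC_norm \<Omega> \<iota> v))"
    by (rule SUP_upper2[OF w]) (simp add: le)
qed

end
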